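(* Let $\lambda_i\neq\lambda_j$ be two eigenvalues. On the two-eigenvalue face, suppose that a polynomial filter changes the initial imbalance from $s_0$ to $s_0^{(q)}$, and both satisfy $0<|s_0|,|s_0^{(q)}|<s_*$, where $0<s_*<1$. Then the exact time saved is \[ T_{\rm esc}(s_0)-T_{\rm esc}(s_0^{(q)})=\frac1{2\gamma_{ij}}\log\left(\frac{(s_0^{(q)})^2(1-s_0^2)}{s_0^2(1-(s_0^{(q)})^2)}\right). \] If both imbalances are small (i.e. as $s_0,s_0^{(q)}\to0$), then \[ T_{\rm esc}(s_0)-T_{\rm esc}(s_0^{(q)})=\frac1{\gamma_{ij}}\log\frac{|s_0^{(q)}|}{|s_0|}+o(1). \] In particular, doubling the unstable imbalance saves approximately (up to $o(1)$) \[ \frac{\log2}{2|\lambda_i-\lambda_j|^2} \] units of residual-flow time.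
   Context: $A=\operatorname{diag}(\lambda_1,\dots,\lambda_n)$ is normal, and the residual flow on the simplex $\{p_k\ge0,\sum_kp_k=1\}$ is $\dot p_k=4p_k(\rho(p)-|\lambda_k-z(p)|^2)$ with $z(p)=\sum_lp_l\lambda_l$, $\rho(p)=\sum_lp_l|\lambda_l-z(p)|^2$. The two-eigenvalue face is the invariant set of $p$ with $p_k=0$ for $k\ne i,j$; there the imbalance is $s=p_i-p_j$. Put $\gamma_{ij}=2|\lambda_i-\lambda_j|^2$. For a threshold $s_*$, $T_{\rm esc}(s_0)$ is the time at which the trajectory on this face starting with imbalance $s(0)=s_0$ first satisfies $|s(t)|=s_*$. A polynomial filter $q$ (with $q(\lambda_k)\ne0$ for all $k$) replaces a unit vector $u$ by $q(A)u/\|q(A)u\|$, hence the weights $p_k$ by $|q(\lambda_k)|^2p_k/\sum_l|q(\lambda_l)|^2p_l$; $s_0^{(q)}$ is the imbalance after this replacement. *)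

theory Defs
  imports "HOL-Analysis.Analysis" "HOL-Computational_Algebra.Polynomial"
begin

definition diag_matrix :: "complex ^ 'n \<Rightarrow> complex ^ 'n ^ 'n" where
  "diag_matrix lam = (\<chi> k l. if k = l then lam $ k else 0)"

text \<open>The multiplication of the type of square matrices as vectors is componentwise, so
  the library's polynomial evaluation does not give q(A). The action of q(A) on u is written out.\<close>

definition poly_matrix_apply :: "complex poly \<Rightarrow> complex ^ 'n ^ 'n \<Rightarrow> complex ^ 'n \<Rightarrow> complex ^ 'n" where
  "poly_matrix_apply q A u = (\<Sum>k\<le>degree q. coeff q k *s (((\<lambda>v. A *v v) ^^ k) u))"

definition poly_filter :: "complex poly \<Rightarrow> complex ^ 'n ^ 'n \<Rightarrow> complex ^ 'n \<Rightarrow> complex ^ 'n" where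
  "poly_filter q A u = poly_matrix_apply q A u /\<^sub>R norm (poly_matrix_apply q A u)"

definition weights :: "complex ^ 'n \<Rightarrow> real ^ 'n" where
  "weights u = (\<chi> k. (cmod (u $ k))\<^sup>2)"

definition weight_simplex :: "(real ^ 'n) set" where
  "weight_simplex = {p. (\<forall>k. 0 \<le> p $ k) \<and> (\<Sum>k\<in>UNIV. p $ k) = 1}"

definition mean_eig :: "complex ^ 'n \<Rightarrow> real ^ 'n \<Rightarrow> complex" where
  "mean_eig lam p = (\<Sum>l\<in>UNIV. of_real (p $ l) * lam $ l)"

definition residual :: "complex ^ 'n \<Rightarrow> real ^ 'n \<Rightarrow> real" where
  "residual lam p = (\<Sum>l\<in>UNIV. p $ l * (cmod (lam $ l - mean_eig lam p))\<^sup>2)"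

definition residual_field :: "complex ^ 'n \<Rightarrow> real ^ 'n \<Rightarrow> real ^ 'n" where
  "residual_field lam p =
     (\<chi> k. 4 * p $ k * (residual lam p - (cmod (lam $ k - mean_eig lam p))\<^sup>2))"

definition residual_trajectory :: "complex ^ 'n \<Rightarrow> (real \<Rightarrow> real ^ 'n) \<Rightarrow> bool" where
  "residual_trajectory lam p \<longleftrightarrow>
     (\<forall>t\<ge>0. p t \<in> weight_simplex \<and>
        (p has_vector_derivative residual_field lam (p t)) (at t within {0..}))"

definition two_face :: "'n \<Rightarrow> 'n \<Rightarrow> (real ^ 'n) set" where
  "two_face i j = {p \<in> weight_simplex. \<forall>k. k \<noteq> i \<and> k \<noteq> j \<longrightarrow> p $ k = 0}"

definition imbalance :: "'n \<Rightarrow> 'n \<Rightarrow> real ^ 'n \<Rightarrow> real" where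
  "imbalance i j p = p $ i - p $ j"

definition escapes_at :: "'n \<Rightarrow> 'n \<Rightarrow> real \<Rightarrow> (real \<Rightarrow> real ^ 'n) \<Rightarrow> real \<Rightarrow> bool" where
  "escapes_at i j sthr p T \<longleftrightarrow>
     0 \<le> T \<and> \<bar>imbalance i j (p T)\<bar> = sthr \<and> (\<forall>t. 0 \<le> t \<and> t < T \<longrightarrow> \<bar>imbalance i j (p t)\<bar> \<noteq> sthr)"

text \<open>The trajectory with the given starting point is unique only on nonnegative times, so
  the description ranges over the time rather than over the trajectory. For
  distinct i and j, the point of the face with imbalance s0 is determined by s0.\<close>

definition escape_time :: "complex ^ 'n \<Rightarrow> 'n \<Rightarrow> 'n \<Rightarrow> real \<Rightarrow> real \<Rightarrow> real" where
  "escape_time lam i j sthr s0 =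
     (THE T. \<exists>p. residual_trajectory lam p \<and> p 0 \<in> two_face i j \<and> imbalance i j (p 0) = s0 \<and>
                 escapes_at i j sthr p T)"

definition gap_rate :: "complex ^ 'n \<Rightarrow> 'n \<Rightarrow> 'n \<Rightarrow> real" where
  "gap_rate lam i j = 2 * (cmod (lam $ i - lam $ j))\<^sup>2"

text \<open>All pairs (imbalance before filtering, imbalance after filtering) arising from
  a unit vector with weights on the face and an admissible polynomial filter.\<close>

definition filter_imbalances :: "complex ^ 'n \<Rightarrow> 'n \<Rightarrow> 'n \<Rightarrow> (real \<times> real) set" where
  "filter_imbalances lam i j =
     {(imbalance i j (weights u), imbalance i j (weights (poly_filter q (diag_matrix lam) u))) | u q.
        norm u = 1 \<and> weights u \<in> two_face i j \<and> (\<forall>k. poly q (lam $ k) \<noteq> 0)}"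

end

theory Submission
  imports Defs
begin

text \<open>On the face spanned by two distinct eigenvalues the state is determined by the imbalance s,
  and there the residual flow is the scalar equation s' = g s (1 - s^2), where
  g = 2 |lam i - lam j|^2. Along it the odds s^2 / (1 - s^2) are
  multiplied by exp (2 g t), so that the threshold S is reached at the single time
    T(s0) = 1/(2g) ln (S^2 (1 - s0^2) / (s0^2 (1 - S^2))).
  In a difference of two such times the threshold cancels, which is the exact formula. Splitting its
  logarithm gives ln (|sq| / |s0|) / g plus a term that is continuous and vanishes at the origin,
  and this yields both asymptotic claims.

  The escape time is a definite description ranging over all trajectories on nonnegative
  times, so the formula for T(s0) takes two arguments: some trajectory has this escape time
  (\<open>logistic_trajectory\<close>, the explicit solution), and each trajectory that starts on the face
  with imbalance s0 has it (\<open>escapes_at_iff\<close>).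
  For the latter, a Gronwall estimate (\<open>gronwall_zero\<close>) is used twice: to show that
  the trajectory stays on the face (\<open>two_face_invariant\<close>), and to show that
  s obeys the multiplication law of the odds (\<open>imbalance_law\<close>).\<close>

section \<open>Vanishing from a differential inequality\<close>

text \<open>The function \<open>f t * exp (- C * t)\<close> is nonincreasing, starts at zero and is nonnegative.\<close>

lemma gronwall_zero:
  fixes f f' :: "real \<Rightarrow> real"
  assumes deriv: "\<And>t. 0 \<le> t \<Longrightarrow> (f has_real_derivative f' t) (at t within {0..})"
    and growth: "\<And>t. 0 \<le> t \<Longrightarrow> f' t \<le> C * f t"
    and nonneg: "\<And>t. 0 \<le> t \<Longrightarrow> 0 \<le> f t"
    and init: "f 0 = 0" and "0 \<le> t"
  shows "f t = 0"
proof -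
  let ?h = "\<lambda>t. f t * exp (- C * t)"
  have dh: "(?h has_real_derivative (f' x - C * f x) * exp (- C * x)) (at x within {0..})"
    if "0 \<le> x" for x
    by (rule derivative_eq_intros deriv[OF that] refl | simp add: algebra_simps)+
  have "?h t \<le> ?h 0"
  proof (rule DERIV_nonpos_imp_decreasing_open[OF \<open>0 \<le> t\<close>])
    fix x :: real assume x: "0 < x" "x < t"
    have "(?h has_real_derivative (f' x - C * f x) * exp (- C * x)) (at x)"
      using dh[of x] x at_within_interior[of x "{0..}"] by simp
    moreover have "(f' x - C * f x) * exp (- C * x) \<le> 0"
      using growth[of x] x by (simp add: mult_nonpos_nonneg)
    ultimately show "\<exists>y. (?h has_real_derivative y) (at x) \<and> y \<le> 0"
      by blast
  next
    have "continuous_on {0..} ?h"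
      by (rule DERIV_continuous_on[OF dh]) simp
    then show "continuous_on {0..t} ?h"
      by (rule continuous_on_subset) auto
  qed
  then have "f t \<le> 0"
    using init by (simp add: mult_le_0_iff)
  then show ?thesis
    using nonneg[OF \<open>0 \<le> t\<close>] by simp
qed

section \<open>The residual flow on a two-eigenvalue face\<close>

definition face_point :: "'n \<Rightarrow> 'n \<Rightarrow> real \<Rightarrow> real ^ 'n" where
  "face_point i j s = (1/2) *\<^sub>R (axis i 1 + axis j 1) + (s/2) *\<^sub>R (axis i 1 - axis j 1)"

lemma face_point_nth:
  assumes "i \<noteq> j"
  shows "face_point i j s $ k = (if k = i then (1 + s)/2 else if k = j then (1 - s)/2 else 0)"
  using assms by (auto simp: face_point_def axis_def field_simps)

lemma imbalance_face_point:
  assumes "i \<noteq> j"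
  shows "imbalance i j (face_point i j s) = s"
  using assms by (simp add: imbalance_def face_point_nth field_simps)

lemma sum_on_face:
  fixes f :: "'n::finite \<Rightarrow> 'a::comm_monoid_add"
  assumes "i \<noteq> j" and "\<And>k. k \<noteq> i \<Longrightarrow> k \<noteq> j \<Longrightarrow> f k = 0"
  shows "(\<Sum>k\<in>UNIV. f k) = f i + f j"
proof -
  have "(\<Sum>k\<in>UNIV. f k) = (\<Sum>k\<in>{i,j}. f k)"
    using assms(2) by (intro sum.mono_neutral_right) auto
  then show ?thesis
    using assms(1) by simp
qed

lemma two_face_eq_face_point:
  assumes "i \<noteq> j" and "p \<in> two_face i j"
  shows "p = face_point i j (imbalance i j p)"
proof -
  have "p $ i + p $ j = 1"
    using assms sum_on_face[OF assms(1), of "($) p"]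
    by (auto simp: two_face_def weight_simplex_def)
  then show ?thesis
    using assms by (auto simp: vec_eq_iff face_point_nth imbalance_def two_face_def field_simps)
qed

lemma face_point_in_two_face:
  assumes "i \<noteq> j" and "\<bar>s\<bar> \<le> 1"
  shows "face_point i j s \<in> two_face i j"
  using assms sum_on_face[OF assms(1), of "($) (face_point i j s)"]
  by (auto simp: two_face_def weight_simplex_def face_point_nth abs_le_iff field_simps)

lemma imbalance_bound:
  assumes "i \<noteq> j" and "p \<in> two_face i j"
  shows "\<bar>imbalance i j p\<bar> \<le> 1"
proof -
  define s where "s = imbalance i j p"
  have "p = face_point i j s"
    unfolding s_def by (rule two_face_eq_face_point[OF assms])
  moreover have "0 \<le> p $ i" "0 \<le> p $ j"
    using assms(2) by (auto simp: two_face_def weight_simplex_def)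
  ultimately show ?thesis
    using assms(1) unfolding s_def[symmetric] by (simp add: face_point_nth abs_le_iff)
qed

text \<open>The mean divides the segment from \<open>lam $ j\<close> to \<open>lam $ i\<close> in the ratio of the weights, so each
  eigenvalue's distance from the mean is the gap times the weight of the other one.\<close>

lemma residual_field_face_point:
  fixes lam :: "complex ^ 'n"
  assumes "i \<noteq> j"
  shows "residual_field lam (face_point i j s) =
           (gap_rate lam i j * s * (1 - s\<^sup>2) / 2) *\<^sub>R (axis i 1 - axis j 1)"
proof -
  let ?p = "face_point i j s"
  define d where "d = cmod (lam $ i - lam $ j)"
  have pi: "?p $ i = (1 + s)/2" and pj: "?p $ j = (1 - s)/2"
    using assms by (auto simp: face_point_nth)
  have mean: "mean_eig lam ?p = of_real ((1 + s)/2) * lam $ i + of_real ((1 - s)/2) * lam $ j"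
    unfolding mean_eig_def by (subst sum_on_face[OF assms]) (auto simp: pi pj, simp add: face_point_nth assms)
  have "lam $ i - mean_eig lam ?p = of_real ((1 - s)/2) * (lam $ i - lam $ j)"
       "lam $ j - mean_eig lam ?p = of_real (-(1 + s)/2) * (lam $ i - lam $ j)"
    unfolding mean by (simp_all add: field_simps)
  then have dist: "(cmod (lam $ i - mean_eig lam ?p))\<^sup>2 = ((1 - s)/2)\<^sup>2 * d\<^sup>2"
       "(cmod (lam $ j - mean_eig lam ?p))\<^sup>2 = ((1 + s)/2)\<^sup>2 * d\<^sup>2"
    by (simp_all only: norm_mult power_mult_distrib norm_of_real power2_abs d_def)
       (simp_all add: power_divide power2_eq_square field_simps)
  have res: "residual lam ?p = (1 - s\<^sup>2)/4 * d\<^sup>2"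
    unfolding residual_def
    by (subst sum_on_face[OF assms])
       (simp add: face_point_nth assms, simp add: pi pj dist, simp add: power2_eq_square field_simps)
  show ?thesis
    unfolding vec_eq_iff
  proof
    fix k
    consider "k = i" | "k = j" | "k \<noteq> i" "k \<noteq> j" by blast
    then show "residual_field lam ?p $ k =
        ((gap_rate lam i j * s * (1 - s\<^sup>2) / 2) *\<^sub>R (axis i 1 - axis j 1)) $ k"
    proof cases
      case 1
      then show ?thesis
        using assms
        by (simp add: residual_field_def res dist pi axis_def gap_rate_def d_def[symmetric])
           (simp add: power2_eq_square field_simps)
    next
      case 2
      then show ?thesis
        using assms
        by (simp add: residual_field_def res dist pj axis_def gap_rate_def d_def[symmetric])
           (simp add: power2_eq_square field_simps)
    next
      case 3
      then show ?thesis
        using assms by (simp add: residual_field_def face_point_nth axis_def)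
    qed
  qed
qed

section \<open>Trajectories that start on the face\<close>

text \<open>A crude bound suffices: it only serves as the constant of the Gronwall estimate.\<close>

lemma residual_le:
  assumes "p \<in> weight_simplex"
  shows "residual lam p \<le> (2 * norm lam)\<^sup>2"
proof -
  have p: "0 \<le> p $ l" and sum: "(\<Sum>l\<in>UNIV. p $ l) = 1" for l
    using assms by (auto simp: weight_simplex_def)
  have "cmod (mean_eig lam p) \<le> (\<Sum>l\<in>UNIV. p $ l * norm lam)"
    unfolding mean_eig_def
    by (rule sum_norm_le) (auto simp: norm_mult p intro!: mult_left_mono Finite_Cartesian_Product.norm_nth_le)
  also have "\<dots> = norm lam"
    by (simp add: sum_distrib_right[symmetric] sum)
  finally have mean: "cmod (mean_eig lam p) \<le> norm lam" .
  have "cmod (lam $ l - mean_eig lam p) \<le> 2 * norm lam" for l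
    using norm_triangle_ineq4[of "lam $ l" "mean_eig lam p"] Finite_Cartesian_Product.norm_nth_le[of lam l] mean by linarith
  then have "residual lam p \<le> (\<Sum>l\<in>UNIV. p $ l * (2 * norm lam)\<^sup>2)"
    unfolding residual_def by (intro sum_mono mult_left_mono power_mono p) auto
  also have "\<dots> = (2 * norm lam)\<^sup>2"
    by (simp only: sum_distrib_right[symmetric] sum mult_1)
  finally show ?thesis .
qed

lemma trajectory_component_deriv:
  assumes "residual_trajectory lam p" and "0 \<le> t"
  shows "((\<lambda>t. p t $ k) has_real_derivative residual_field lam (p t) $ k) (at t within {0..})"
  using assms unfolding residual_trajectory_def has_real_derivative_iff_has_vector_derivative
  by (blast intro: bounded_linear.has_vector_derivative[OF bounded_linear_vec_nth])

lemma two_face_invariant: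
  assumes traj: "residual_trajectory lam p" and init: "p 0 \<in> two_face i j" and "0 \<le> t"
  shows "p t \<in> two_face i j"
proof -
  have simplex: "p t \<in> weight_simplex" if "0 \<le> t" for t
    using traj that by (simp add: residual_trajectory_def)
  have nonneg: "0 \<le> p t $ k" if "0 \<le> t" for t k
    using simplex[OF that] by (simp add: weight_simplex_def)
  have "p t $ k = 0" if k: "k \<noteq> i" "k \<noteq> j" for k
  proof (rule gronwall_zero[OF trajectory_component_deriv[OF traj] _ nonneg _ \<open>0 \<le> t\<close>])
    fix t :: real assume t: "0 \<le> t"
    have "residual lam (p t) - (cmod (lam $ k - mean_eig lam (p t)))\<^sup>2 \<le> (2 * norm lam)\<^sup>2"
      using residual_le[OF simplex[OF t], of lam]
      by (rule order_trans[rotated]) simp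
    then have "4 * p t $ k * (residual lam (p t) - (cmod (lam $ k - mean_eig lam (p t)))\<^sup>2)
        \<le> 4 * p t $ k * (2 * norm lam)\<^sup>2"
      using nonneg[OF t, of k] by (intro mult_left_mono) auto
    then show "residual_field lam (p t) $ k \<le> (4 * (2 * norm lam)\<^sup>2) * p t $ k"
      by (simp add: residual_field_def ac_simps)
  qed (use init k in \<open>auto simp: two_face_def\<close>)
  then show ?thesis
    using simplex[OF \<open>0 \<le> t\<close>] by (simp add: two_face_def)
qed

lemma imbalance_deriv:
  assumes traj: "residual_trajectory lam p" and init: "p 0 \<in> two_face i j"
    and "i \<noteq> j" and t: "0 \<le> t"
  defines "s \<equiv> \<lambda>t. imbalance i j (p t)"
  shows "(s has_real_derivative gap_rate lam i j * s t * (1 - (s t)\<^sup>2)) (at t within {0..})"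
proof -
  have "p t = face_point i j (s t)"
    unfolding s_def
    by (rule two_face_eq_face_point[OF \<open>i \<noteq> j\<close> two_face_invariant[OF traj init t]])
  then have "residual_field lam (p t) $ i - residual_field lam (p t) $ j =
      gap_rate lam i j * s t * (1 - (s t)\<^sup>2)"
    using \<open>i \<noteq> j\<close> residual_field_face_point[OF \<open>i \<noteq> j\<close>, of lam "s t"] by (simp add: axis_def)
  moreover have "(s has_real_derivative
      residual_field lam (p t) $ i - residual_field lam (p t) $ j) (at t within {0..})"
    unfolding s_def imbalance_def
    by (intro DERIV_diff trajectory_component_deriv[OF traj t])
  ultimately show ?thesis by simp
qed

text \<open>The law \<open>s\<^sup>2 / (1 - s\<^sup>2) = s0\<^sup>2 / (1 - s0\<^sup>2) * exp (2 * g * t)\<close>, cleared of denominators.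
  In this form it makes sense at the vertices \<open>s = 1\<close> and \<open>s = -1\<close> as well,
  and the difference \<open>G\<close> of the two sides satisfies the linear equation \<open>G' = 2 * g * (1 - s\<^sup>2) * G\<close>,
  so that the Gronwall estimate applies to \<open>G\<^sup>2\<close>.\<close>

lemma imbalance_law:
  assumes traj: "residual_trajectory lam p" and init: "p 0 \<in> two_face i j"
    and "i \<noteq> j" and t: "0 \<le> t"
  defines "s \<equiv> \<lambda>t. imbalance i j (p t)" and "E \<equiv> \<lambda>t. exp (2 * gap_rate lam i j * t)"
  shows "(s t)\<^sup>2 * (1 - (s 0)\<^sup>2 + (s 0)\<^sup>2 * E t) = (s 0)\<^sup>2 * E t"
proof -
  define g where "g = gap_rate lam i j"
  have g: "0 \<le> g"
    by (simp add: g_def gap_rate_def)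
  define G where "G = (\<lambda>t. (s t)\<^sup>2 * (1 - (s 0)\<^sup>2 + (s 0)\<^sup>2 * E t) - (s 0)\<^sup>2 * E t)"
  have "(G t)\<^sup>2 = 0"
  proof (rule gronwall_zero[where f = "\<lambda>t. (G t)\<^sup>2" and C = "4 * g", OF _ _ _ _ t])
    fix t :: real assume t: "0 \<le> t"
    have s: "(s has_real_derivative g * s t * (1 - (s t)\<^sup>2)) (at t within {0..})"
      unfolding s_def g_def by (rule imbalance_deriv[OF traj init \<open>i \<noteq> j\<close> t])
    have E: "(E has_real_derivative 2 * g * E t) (at t within {0..})"
      unfolding E_def g_def by (rule derivative_eq_intros refl | simp)+
    have "(G has_real_derivative 2 * g * (1 - (s t)\<^sup>2) * G t) (at t within {0..})"
      unfolding G_def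
      by (rule derivative_eq_intros s E refl | simp)+
         (simp add: power2_eq_square algebra_simps)
    then show "((\<lambda>t. (G t)\<^sup>2) has_real_derivative 4 * g * (1 - (s t)\<^sup>2) * (G t)\<^sup>2)
        (at t within {0..})"
      by (rule DERIV_power[THEN DERIV_cong]) (simp add: power2_eq_square)
    show "4 * g * (1 - (s t)\<^sup>2) * (G t)\<^sup>2 \<le> 4 * g * (G t)\<^sup>2"
      using g by (intro mult_right_mono) (auto simp: mult_left_le)
  qed (auto simp: G_def E_def)
  then show ?thesis
    by (simp add: G_def)
qed

text \<open>The law of the odds (see \<open>imbalance_law\<close>) solved for \<open>s\<close>, taking the root with the sign
  of \<open>s0\<close>.\<close>

definition logistic_solution :: "real \<Rightarrow> real \<Rightarrow> real \<Rightarrow> real" where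
  "logistic_solution g s0 t = s0 * exp (g * t) / sqrt (1 - s0\<^sup>2 + s0\<^sup>2 * (exp (g * t))\<^sup>2)"

lemma logistic_trajectory:
  fixes lam :: "complex ^ 'n"
  assumes "i \<noteq> j" and s0: "\<bar>s0\<bar> < 1"
  shows "residual_trajectory lam (\<lambda>t. face_point i j (logistic_solution (gap_rate lam i j) s0 t))"
  unfolding residual_trajectory_def
proof (intro allI impI conjI)
  define g where "g = gap_rate lam i j"
  define s where "s = logistic_solution g s0"
  define D where "D = (\<lambda>t. 1 - s0\<^sup>2 + s0\<^sup>2 * (exp (g * t))\<^sup>2)"
  have "s0\<^sup>2 < 1"
    using s0 by (simp add: abs_square_less_1)
  then have D: "0 < D t" for t
    unfolding D_def by (simp add: add_pos_nonneg)
  have s: "s t = s0 * exp (g * t) / sqrt (D t)" for t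
    by (simp add: s_def logistic_solution_def D_def)
  have s_sq: "(s t)\<^sup>2 = s0\<^sup>2 * (exp (g * t))\<^sup>2 / D t" for t
    using D[of t] by (simp add: s power_divide power_mult_distrib)
  have "s0\<^sup>2 * (exp (g * t))\<^sup>2 \<le> D t" for t
    using \<open>s0\<^sup>2 < 1\<close> by (simp add: D_def)
  then have "(s t)\<^sup>2 \<le> 1" for t
    using D[of t] by (simp add: s_sq)
  then have "\<bar>s t\<bar> \<le> 1" for t
    by (simp add: abs_square_le_1)
  fix t :: real
  show "face_point i j (logistic_solution (gap_rate lam i j) s0 t) \<in> weight_simplex"
    using face_point_in_two_face[OF \<open>i \<noteq> j\<close> \<open>\<bar>s t\<bar> \<le> 1\<close>] by (simp add: two_face_def s_def g_def)
  have E: "((\<lambda>t. exp (g * t)) has_real_derivative g * exp (g * t)) (at t)" for t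
    by (rule derivative_eq_intros refl | simp)+
  have dD: "(D has_real_derivative 2 * g * s0\<^sup>2 * (exp (g * t))\<^sup>2) (at t)"
    unfolding D_def
    by (rule derivative_eq_intros E refl | simp add: power2_eq_square)+
  have dsqrt: "((\<lambda>t. sqrt (D t)) has_real_derivative g * (s t)\<^sup>2 * sqrt (D t)) (at t)"
  proof (rule DERIV_cong)
    show "((\<lambda>t. sqrt (D t)) has_real_derivative
        inverse (sqrt (D t)) / 2 * (2 * g * s0\<^sup>2 * (exp (g * t))\<^sup>2)) (at t)"
      by (rule DERIV_chain2[OF DERIV_real_sqrt[OF D] dD])
    show "inverse (sqrt (D t)) / 2 * (2 * g * s0\<^sup>2 * (exp (g * t))\<^sup>2) = g * (s t)\<^sup>2 * sqrt (D t)"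
      using D[of t] real_sqrt_mult_self[of "D t"] by (simp add: s_sq field_simps)
  qed
  have ds: "(s has_real_derivative g * s t * (1 - (s t)\<^sup>2)) (at t)"
  proof -
    have "((\<lambda>t. s0 * exp (g * t) / sqrt (D t)) has_real_derivative
        (s0 * (g * exp (g * t)) * sqrt (D t) - s0 * exp (g * t) * (g * (s t)\<^sup>2 * sqrt (D t)))
          / (sqrt (D t) * sqrt (D t))) (at t)"
      using D[of t] by (intro DERIV_divide DERIV_cmult E dsqrt) simp
    moreover have "(s0 * (g * exp (g * t)) * sqrt (D t) - s0 * exp (g * t) * (g * (s t)\<^sup>2 * sqrt (D t)))
          / (sqrt (D t) * sqrt (D t)) = g * s t * (1 - (s t)\<^sup>2)"
    proof -
      define r where "r = sqrt (D t)"
      have "r \<noteq> 0" using D[of t] by (simp add: r_def)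
      then have "(s0 * (g * x) * r - s0 * x * (g * y * r)) / (r * r) = g * (s0 * x / r) * (1 - y)"
        for x y by (simp add: field_simps)
      then show ?thesis
        by (simp only: s[of t, symmetric] r_def)
    qed
    ultimately show ?thesis
      by (simp add: s[abs_def])
  qed
  have "((\<lambda>t. face_point i j (s t)) has_vector_derivative
      (g * s t * (1 - (s t)\<^sup>2) / 2) *\<^sub>R (axis i 1 - axis j 1)) (at t within {0..})"
  proof -
    have "((\<lambda>t. s t / 2) has_real_derivative g * s t * (1 - (s t)\<^sup>2) / 2) (at t within {0..})"
      by (rule DERIV_cdivide[OF has_field_derivative_at_within[OF ds]])
    then have "((\<lambda>t. (s t / 2) *\<^sub>R (axis i 1 - axis j 1 :: real ^ 'n)) has_vector_derivative
        (g * s t * (1 - (s t)\<^sup>2) / 2) *\<^sub>R (axis i 1 - axis j 1)) (at t within {0..})"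
      by (auto dest: has_vector_derivative_scaleR[OF _ has_vector_derivative_const])
    from has_vector_derivative_add[OF has_vector_derivative_const this]
    show ?thesis
      unfolding face_point_def by simp
  qed
  then show "((\<lambda>t. face_point i j (logistic_solution (gap_rate lam i j) s0 t)) has_vector_derivative
      residual_field lam (face_point i j (logistic_solution (gap_rate lam i j) s0 t))) (at t within {0..})"
    by (simp add: residual_field_face_point[OF \<open>i \<noteq> j\<close>] s_def g_def)
qed

section \<open>The escape time\<close>

lemma gap_rate_pos:
  assumes "lam $ i \<noteq> lam $ j"
  shows "0 < gap_rate lam i j"
  using assms by (simp add: gap_rate_def)

text \<open>The factor by which the odds \<open>s\<^sup>2 / (1 - s\<^sup>2)\<close> have to grow between \<open>s0\<close> and the threshold.\<close>

definition escape_ratio :: "real \<Rightarrow> real \<Rightarrow> real" where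
  "escape_ratio S s0 = (S\<^sup>2 * (1 - s0\<^sup>2)) / (s0\<^sup>2 * (1 - S\<^sup>2))"

lemma square_bounds:
  fixes s S :: real
  assumes "0 < \<bar>s\<bar>" and "\<bar>s\<bar> < S" and "S < 1"
  shows "0 < s\<^sup>2" "s\<^sup>2 < S\<^sup>2" "S\<^sup>2 < 1"
  using assms power_strict_mono[of "\<bar>s\<bar>" S 2] abs_square_less_1[of S] by auto

lemma escape_ratio_ge_1:
  assumes "0 < \<bar>s0\<bar>" and "\<bar>s0\<bar> < S" and "S < 1"
  shows "1 \<le> escape_ratio S s0"
proof -
  from square_bounds[OF assms] show ?thesis
    by (simp add: escape_ratio_def field_simps)
qed

lemma threshold_iff_time:
  assumes traj: "residual_trajectory lam p" and init: "p 0 \<in> two_face i j"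
    and ne: "lam $ i \<noteq> lam $ j" and t: "0 \<le> t"
    and s0: "imbalance i j (p 0) = s0" "0 < \<bar>s0\<bar>" "\<bar>s0\<bar> < S" "S < 1"
  shows "\<bar>imbalance i j (p t)\<bar> = S \<longleftrightarrow> t = ln (escape_ratio S s0) / (2 * gap_rate lam i j)"
proof -
  define s where "s = imbalance i j (p t)"
  define g where "g = gap_rate lam i j"
  define E where "E = exp (2 * g * t)"
  have "i \<noteq> j" using ne by auto
  have g: "0 < g" unfolding g_def by (rule gap_rate_pos[OF ne])
  note sq = square_bounds[OF s0(2-4)]
  have "0 < E" by (simp add: E_def)
  have law: "s\<^sup>2 * (1 - s0\<^sup>2 + s0\<^sup>2 * E) = s0\<^sup>2 * E"
    using imbalance_law[OF traj init \<open>i \<noteq> j\<close> t] by (simp add: s0(1) s_def E_def g_def)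
  have pos: "0 < 1 - s0\<^sup>2 + s0\<^sup>2 * E"
    using sq \<open>0 < E\<close> by (intro add_pos_pos) auto
  have "\<bar>s\<bar> = S \<longleftrightarrow> s\<^sup>2 = S\<^sup>2"
    using s0 by (simp add: abs_eq_iff' power2_eq_iff) auto
  also have "\<dots> \<longleftrightarrow> S\<^sup>2 * (1 - s0\<^sup>2 + s0\<^sup>2 * E) = s0\<^sup>2 * E"
    using law pos by (metis mult_right_cancel less_irrefl)
  also have "\<dots> \<longleftrightarrow> E = escape_ratio S s0"
    using sq by (auto simp: escape_ratio_def field_simps)
  also have "\<dots> \<longleftrightarrow> 2 * g * t = ln (escape_ratio S s0)"
    using escape_ratio_ge_1[OF s0(2-4)] unfolding E_def
    by (metis exp_ln ln_exp less_le_trans zero_less_one)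
  also have "\<dots> \<longleftrightarrow> t = ln (escape_ratio S s0) / (2 * g)"
    using g by (auto simp: field_simps)
  finally show ?thesis
    by (simp add: s_def g_def)
qed

lemma escapes_at_iff:
  assumes "residual_trajectory lam p" and "p 0 \<in> two_face i j" and ne: "lam $ i \<noteq> lam $ j"
    and s0: "imbalance i j (p 0) = s0" "0 < \<bar>s0\<bar>" "\<bar>s0\<bar> < S" "S < 1"
  shows "escapes_at i j S p T \<longleftrightarrow> T = ln (escape_ratio S s0) / (2 * gap_rate lam i j)"
proof -
  have "0 \<le> ln (escape_ratio S s0) / (2 * gap_rate lam i j)"
    using escape_ratio_ge_1[OF s0(2-4)] gap_rate_pos[OF ne] by simp
  then show ?thesis
    using threshold_iff_time[OF assms(1-3) _ s0] by (auto simp: escapes_at_def)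
qed

theorem escape_time_eq:
  assumes ne: "lam $ i \<noteq> lam $ j" and s0: "0 < \<bar>s0\<bar>" "\<bar>s0\<bar> < S" "S < 1"
  shows "escape_time lam i j S s0 = ln (escape_ratio S s0) / (2 * gap_rate lam i j)"
  unfolding escape_time_def
proof (rule the_equality)
  have "i \<noteq> j" using ne by auto
  define p where "p = (\<lambda>t. face_point i j (logistic_solution (gap_rate lam i j) s0 t))"
  have "residual_trajectory lam p"
    unfolding p_def using s0 by (intro logistic_trajectory \<open>i \<noteq> j\<close>) simp
  moreover have "p 0 = face_point i j s0"
    by (simp add: p_def logistic_solution_def)
  then have "p 0 \<in> two_face i j" "imbalance i j (p 0) = s0"
    using face_point_in_two_face[OF \<open>i \<noteq> j\<close>] imbalance_face_point[OF \<open>i \<noteq> j\<close>] s0 by auto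
  ultimately show "\<exists>p. residual_trajectory lam p \<and> p 0 \<in> two_face i j \<and> imbalance i j (p 0) = s0 \<and>
      escapes_at i j S p (ln (escape_ratio S s0) / (2 * gap_rate lam i j))"
    using escapes_at_iff[OF _ _ ne _ s0] by blast
qed (use escapes_at_iff[OF _ _ ne _ s0] in blast)

section \<open>The time saved by a change of the imbalance\<close>

lemma escape_time_diff:
  assumes ne: "lam $ i \<noteq> lam $ j" and "S < 1"
    and s0: "0 < \<bar>s0\<bar>" "\<bar>s0\<bar> < S" and sq: "0 < \<bar>sq\<bar>" "\<bar>sq\<bar> < S"
  shows "escape_time lam i j S s0 - escape_time lam i j S sq =
           1 / (2 * gap_rate lam i j) * ln ((sq\<^sup>2 * (1 - s0\<^sup>2)) / (s0\<^sup>2 * (1 - sq\<^sup>2)))"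
proof -
  note b0 = square_bounds[OF s0 \<open>S < 1\<close>] and bq = square_bounds[OF sq \<open>S < 1\<close>]
  have "(sq\<^sup>2 * (1 - s0\<^sup>2)) / (s0\<^sup>2 * (1 - sq\<^sup>2)) = escape_ratio S s0 / escape_ratio S sq"
    using b0 bq s0 unfolding escape_ratio_def by auto
  moreover have "ln (escape_ratio S s0 / escape_ratio S sq) =
      ln (escape_ratio S s0) - ln (escape_ratio S sq)"
    using escape_ratio_ge_1[OF s0 \<open>S < 1\<close>] escape_ratio_ge_1[OF sq \<open>S < 1\<close>]
    by (intro ln_divide_pos) auto
  ultimately show ?thesis
    by (simp add: escape_time_eq[OF ne s0 \<open>S < 1\<close>] escape_time_eq[OF ne sq \<open>S < 1\<close>] diff_divide_distrib)
qed

lemma escape_time_diff_split: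
  assumes ne: "lam $ i \<noteq> lam $ j" and "S < 1"
    and s0: "0 < \<bar>s0\<bar>" "\<bar>s0\<bar> < S" and sq: "0 < \<bar>sq\<bar>" "\<bar>sq\<bar> < S"
  shows "escape_time lam i j S s0 - escape_time lam i j S sq - 1 / gap_rate lam i j * ln (\<bar>sq\<bar> / \<bar>s0\<bar>) =
           1 / (2 * gap_rate lam i j) * ln ((1 - s0\<^sup>2) / (1 - sq\<^sup>2))"
proof -
  note b0 = square_bounds[OF s0 \<open>S < 1\<close>] and bq = square_bounds[OF sq \<open>S < 1\<close>]
  have "(sq\<^sup>2 * (1 - s0\<^sup>2)) / (s0\<^sup>2 * (1 - sq\<^sup>2)) = (\<bar>sq\<bar> / \<bar>s0\<bar>)\<^sup>2 * ((1 - s0\<^sup>2) / (1 - sq\<^sup>2))"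
    by (simp add: power_divide)
  also have "ln \<dots> = ln ((\<bar>sq\<bar> / \<bar>s0\<bar>)\<^sup>2) + ln ((1 - s0\<^sup>2) / (1 - sq\<^sup>2))"
    using b0 bq s0 sq by (intro ln_mult_pos) auto
  also have "ln ((\<bar>sq\<bar> / \<bar>s0\<bar>)\<^sup>2) = 2 * ln (\<bar>sq\<bar> / \<bar>s0\<bar>)"
    using s0 sq by (subst ln_realpow) auto
  finally show ?thesis
    unfolding escape_time_diff[OF assms] by (simp add: add_divide_distrib)
qed

lemma escape_time_diff_asymptotics:
  assumes ne: "lam $ i \<noteq> lam $ j" and S: "0 < S" "S < 1"
  shows "((\<lambda>(s0, sq). escape_time lam i j S s0 - escape_time lam i j S sq
             - 1 / gap_rate lam i j * ln (\<bar>sq\<bar> / \<bar>s0\<bar>)) \<longlongrightarrow> 0)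
           (at (0, 0) within {(s0, sq). s0 \<noteq> 0 \<and> sq \<noteq> 0})"
proof (rule Lim_transform_eventually)
  let ?F = "at (0, 0) within {(s0, sq). s0 \<noteq> 0 \<and> sq \<noteq> (0::real)} :: (real \<times> real) filter"
  have fst: "(fst \<longlongrightarrow> 0) ?F" and snd: "(snd \<longlongrightarrow> 0) ?F"
    using tendsto_fst[OF tendsto_ident_at, of "(0,0)"] tendsto_snd[OF tendsto_ident_at, of "(0,0)"]
    by auto
  have "((\<lambda>x. 1 / (2 * gap_rate lam i j) * ln ((1 - (fst x)\<^sup>2) / (1 - (snd x)\<^sup>2))) \<longlongrightarrow>
      1 / (2 * gap_rate lam i j) * ln ((1 - 0\<^sup>2) / (1 - 0\<^sup>2))) ?F"
    by (intro tendsto_intros fst snd) auto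
  then show "((\<lambda>(s0, sq). 1 / (2 * gap_rate lam i j) * ln ((1 - s0\<^sup>2) / (1 - sq\<^sup>2))) \<longlongrightarrow> 0) ?F"
    by (simp add: case_prod_beta')
  have "\<forall>\<^sub>F x in ?F. \<bar>fst x\<bar> < S" "\<forall>\<^sub>F x in ?F. \<bar>snd x\<bar> < S"
    using order_tendstoD(2)[OF tendsto_rabs_zero[OF fst] S(1)]
      order_tendstoD(2)[OF tendsto_rabs_zero[OF snd] S(1)] by auto
  moreover have "\<forall>\<^sub>F x in ?F. fst x \<noteq> 0 \<and> snd x \<noteq> 0"
    unfolding eventually_at_filter by (rule always_eventually) auto
  ultimately show "\<forall>\<^sub>F x in ?F.
      (case x of (s0, sq) \<Rightarrow> 1 / (2 * gap_rate lam i j) * ln ((1 - s0\<^sup>2) / (1 - sq\<^sup>2))) =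
      (case x of (s0, sq) \<Rightarrow> escape_time lam i j S s0 - escape_time lam i j S sq
         - 1 / gap_rate lam i j * ln (\<bar>sq\<bar> / \<bar>s0\<bar>))"
  proof eventually_elim
    case (elim x)
    then show ?case
      using escape_time_diff_split[OF ne S(2), of "fst x" "snd x"] by (simp add: case_prod_beta')
  qed
qed

lemma escape_time_doubling:
  assumes ne: "lam $ i \<noteq> lam $ j" and S: "0 < S" "S < 1"
  shows "((\<lambda>(s0, sq). escape_time lam i j S s0 - escape_time lam i j S sq) \<longlongrightarrow>
             ln 2 / gap_rate lam i j) (at (0, 0) within {(s0, sq). s0 \<noteq> 0 \<and> sq = 2 * s0})"
proof (rule Lim_transform_eventually)
  let ?F = "at (0, 0) within {(s0, sq). s0 \<noteq> 0 \<and> sq = 2 * s0} :: (real \<times> real) filter"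
  let ?f = "\<lambda>(s0, sq). escape_time lam i j S s0 - escape_time lam i j S sq
             - 1 / gap_rate lam i j * ln (\<bar>sq\<bar> / \<bar>s0\<bar>)"
  have "(?f \<longlongrightarrow> 0) ?F"
    using escape_time_diff_asymptotics[OF ne S] by (rule tendsto_within_subset) auto
  then show "((\<lambda>x. ?f x + ln 2 / gap_rate lam i j) \<longlongrightarrow> ln 2 / gap_rate lam i j) ?F"
    using tendsto_add[OF _ tendsto_const] by fastforce
  show "\<forall>\<^sub>F x in ?F. ?f x + ln 2 / gap_rate lam i j =
      (case x of (s0, sq) \<Rightarrow> escape_time lam i j S s0 - escape_time lam i j S sq)"
    unfolding eventually_at_filter by (rule always_eventually) (auto simp: abs_mult)
qed

theorem corollary6p4:
  fixes lam :: "complex ^ 'n" and i j :: 'n and sthr :: real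
  assumes "lam $ i \<noteq> lam $ j" and "0 < sthr" and "sthr < 1"
  shows "(\<forall>s0 sq. (s0, sq) \<in> filter_imbalances lam i j \<and>
            0 < \<bar>s0\<bar> \<and> \<bar>s0\<bar> < sthr \<and> 0 < \<bar>sq\<bar> \<and> \<bar>sq\<bar> < sthr \<longrightarrow>
            escape_time lam i j sthr s0 - escape_time lam i j sthr sq =
              1 / (2 * gap_rate lam i j) * ln ((sq\<^sup>2 * (1 - s0\<^sup>2)) / (s0\<^sup>2 * (1 - sq\<^sup>2))))
       \<and> ((\<lambda>(s0, sq). escape_time lam i j sthr s0 - escape_time lam i j sthr sq
              - 1 / gap_rate lam i j * ln (\<bar>sq\<bar> / \<bar>s0\<bar>)) \<longlongrightarrow> 0)
           (at (0, 0) within {(s0, sq) \<in> filter_imbalances lam i j. s0 \<noteq> 0 \<and> sq \<noteq> 0})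
       \<and> ((\<lambda>(s0, sq). escape_time lam i j sthr s0 - escape_time lam i j sthr sq)
            \<longlongrightarrow> ln 2 / (2 * (cmod (lam $ i - lam $ j))\<^sup>2))
           (at (0, 0) within {(s0, sq) \<in> filter_imbalances lam i j. s0 \<noteq> 0 \<and> sq = 2 * s0})"
proof (intro conjI allI impI)
  fix s0 sq
  assume "(s0, sq) \<in> filter_imbalances lam i j \<and>
            0 < \<bar>s0\<bar> \<and> \<bar>s0\<bar> < sthr \<and> 0 < \<bar>sq\<bar> \<and> \<bar>sq\<bar> < sthr"
  then show "escape_time lam i j sthr s0 - escape_time lam i j sthr sq =
              1 / (2 * gap_rate lam i j) * ln ((sq\<^sup>2 * (1 - s0\<^sup>2)) / (s0\<^sup>2 * (1 - sq\<^sup>2)))"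
    using escape_time_diff[OF assms(1,3)] by blast
next
  show "((\<lambda>(s0, sq). escape_time lam i j sthr s0 - escape_time lam i j sthr sq
              - 1 / gap_rate lam i j * ln (\<bar>sq\<bar> / \<bar>s0\<bar>)) \<longlongrightarrow> 0)
           (at (0, 0) within {(s0, sq) \<in> filter_imbalances lam i j. s0 \<noteq> 0 \<and> sq \<noteq> 0})"
    using escape_time_diff_asymptotics[OF assms] by (rule tendsto_within_subset) auto
next
  show "((\<lambda>(s0, sq). escape_time lam i j sthr s0 - escape_time lam i j sthr sq)
            \<longlongrightarrow> ln 2 / (2 * (cmod (lam $ i - lam $ j))\<^sup>2))
           (at (0, 0) within {(s0, sq) \<in> filter_imbalances lam i j. s0 \<noteq> 0 \<and> sq = 2 * s0})"
    using escape_time_doubling[OF assms] unfolding gap_rate_def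
    by (rule tendsto_within_subset) auto
qed

end
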